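(* Consider the following two vector fields acting on a function $\varphi(K,L,f)$, with constants $a,b,c$: $$X_3\varphi = K\left(1-\frac{K}{N_K}\right)\frac{\partial \varphi}{\partial K} + L\left(1-\frac{L}{N_L}\right)\frac{\partial\varphi}{\partial L} + f\left(1-\frac{f}{N_f}\right)\frac{\partial \varphi}{\partial f}=0,$$ $$X_4\varphi = aK\left(1-\frac{K}{N_K}\right)\frac{\partial \varphi}{\partial K} + bL\left(1-\frac{L}{N_L}\right)\frac{\partial\varphi}{\partial L} + cf\left(1-\frac{f}{N_f}\right)\frac{\partial \varphi}{\partial f}=0.$$ The vector fields $X_3,X_4$ form an integrable distribution, since $[X_3,X_4]=0$, and the corresponding total differential equation, which has $\varphi(K,L,f)=\mathrm{const}$ for a solution, is $$(c-b)\frac{dK}{K\left(1-\frac{K}{N_K}\right)} + (a-c)\frac{dL}{L\left(1-\frac{L}{N_L}\right)} + (b-a)\frac{df}{f\left(1-\frac{f}{N_f}\right)}=0.$$ Integrating it yields a solution of the form $\varphi(K,L,f)=0$ defined in the open domain $D=(0,N_K)\times(0,N_L)\times(0,N_f)\subset\mathbb{R}^3$ and satisfying $\frac{\partial\varphi}{\partial f}\not\equiv 0$. Solving for $f$ by the implicit function theorem, one arrives at the production function $$Y=f_5(K,L)=\frac{N_f K^{\alpha}L^{\beta}}{C\,|N_K-K|^{\alpha}\,|N_L-L|^{\beta}+K^{\alpha}L^{\beta}},\qquad (K,L)\in\mathbb{R}_+^2,$$ where $C\in\mathbb{R}$ is the constant of integration, $\alpha=\frac{c-b}{a-b}$ and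 $\beta=\frac{a-c}{a-b}$, so that $\alpha+\beta=1$. The function $f_5$, whose range is $(0,N_f)$, coincides with the function defined by $\varphi(K,L,f)=0$ on $D$.
   Context: $K$ and $L$ denote capital and labor, $f$ (or $Y$) is the production, and $N_K,N_L,N_f$ are the carrying capacities of capital, labor and production respectively; $\mathbb{R}_+^2=\{(K,L): K,L\in\mathbb{R}_+\}$ is the first quadrant. The two equations express that an aggregate production function is simultaneously holothetic under two types of technical change (for instance, those of two sectors of an economy), in each of which capital, labor and production all grow logistically. The function $f_5$ is regarded as defined also outside $(0,N_K)\times(0,N_L)$, i.e. when the factors grow beyond their carrying capacities.
   Formalization: The range and coincidence claims are stated for C > 0 rather than all real C (for C ≤ 0 no value of f_5 lies in (0,N_f)), and the range on the quadrant leaves out the lines K = N_K and L = N_L, where f_5 equals N_f or is undefined. *)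

theory Defs
  imports "HOL-Analysis.Analysis"
begin

text \<open>
  Points and tangent vectors of the three-dimensional space with coordinates \<open>(K, L, f)\<close> are
  triples of reals; a vector field is the triple of its coefficient functions with respect to
  \<open>\<partial>/\<partial>K\<close>, \<open>\<partial>/\<partial>L\<close>, \<open>\<partial>/\<partial>f\<close>.
\<close>

type_synonym point = "real \<times> real \<times> real"
type_synonym vfield = "point \<Rightarrow> point"

definition partial_K :: "(point \<Rightarrow> real) \<Rightarrow> point \<Rightarrow> real" where
  "partial_K \<phi> = (\<lambda>(K, L, f). deriv (\<lambda>x. \<phi> (x, L, f)) K)"

definition partial_L :: "(point \<Rightarrow> real) \<Rightarrow> point \<Rightarrow> real" where
  "partial_L \<phi> = (\<lambda>(K, L, f). deriv (\<lambda>x. \<phi> (K, x, f)) L)"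

definition partial_f :: "(point \<Rightarrow> real) \<Rightarrow> point \<Rightarrow> real" where
  "partial_f \<phi> = (\<lambda>(K, L, f). deriv (\<lambda>x. \<phi> (K, L, x)) f)"

definition C1_on :: "point set \<Rightarrow> (point \<Rightarrow> real) \<Rightarrow> bool" where
  "C1_on U \<phi> \<longleftrightarrow> \<phi> differentiable_on U \<and>
     continuous_on U (partial_K \<phi>) \<and> continuous_on U (partial_L \<phi>) \<and> continuous_on U (partial_f \<phi>)"

definition differential :: "(point \<Rightarrow> real) \<Rightarrow> point \<Rightarrow> point \<Rightarrow> real" where
  "differential \<phi> p = (\<lambda>(u, v, w). partial_K \<phi> p * u + partial_L \<phi> p * v + partial_f \<phi> p * w)"

definition vf_apply :: "vfield \<Rightarrow> (point \<Rightarrow> real) \<Rightarrow> point \<Rightarrow> real" where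
  "vf_apply X \<phi> p = differential \<phi> p (X p)"

definition lie_bracket :: "vfield \<Rightarrow> vfield \<Rightarrow> vfield" where
  "lie_bracket X Y p =
     (vf_apply X (\<lambda>q. fst (Y q)) p - vf_apply Y (\<lambda>q. fst (X q)) p,
      vf_apply X (\<lambda>q. fst (snd (Y q))) p - vf_apply Y (\<lambda>q. fst (snd (X q))) p,
      vf_apply X (\<lambda>q. snd (snd (Y q))) p - vf_apply Y (\<lambda>q. snd (snd (X q))) p)"

text \<open>
  A rank two distribution in three-space is integrable iff it is locally tangent to the level
  surfaces of a function without critical points.
\<close>

definition integrable_distribution :: "point set \<Rightarrow> vfield \<Rightarrow> vfield \<Rightarrow> bool" where
  "integrable_distribution U X Y \<longleftrightarrow>
     (\<forall>p\<in>U. \<forall>s t. s *\<^sub>R X p + t *\<^sub>R Y p = 0 \<longrightarrow> s = 0 \<and> t = 0) \<and>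
     (\<forall>p\<in>U. \<exists>V \<phi>. open V \<and> p \<in> V \<and> V \<subseteq> U \<and> C1_on V \<phi> \<and>
        (\<forall>q\<in>V. (\<exists>v. differential \<phi> q v \<noteq> 0) \<and> vf_apply X \<phi> q = 0 \<and> vf_apply Y \<phi> q = 0))"

definition X3 :: "real \<Rightarrow> real \<Rightarrow> real \<Rightarrow> vfield" where
  "X3 NK NL Nf = (\<lambda>(K, L, f). (K * (1 - K / NK), L * (1 - L / NL), f * (1 - f / Nf)))"

definition X4 :: "real \<Rightarrow> real \<Rightarrow> real \<Rightarrow> real \<Rightarrow> real \<Rightarrow> real \<Rightarrow> vfield" where
  "X4 NK NL Nf a b c =
     (\<lambda>(K, L, f). (a * K * (1 - K / NK), b * L * (1 - L / NL), c * f * (1 - f / Nf)))"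

text \<open>The left-hand side of the total differential equation, as a one-form: point, tangent vector.\<close>

definition total_form ::
    "real \<Rightarrow> real \<Rightarrow> real \<Rightarrow> real \<Rightarrow> real \<Rightarrow> real \<Rightarrow> point \<Rightarrow> point \<Rightarrow> real" where
  "total_form NK NL Nf a b c = (\<lambda>(K, L, f) (dK, dL, df).
     (c - b) * (dK / (K * (1 - K / NK))) + (a - c) * (dL / (L * (1 - L / NL)))
       + (b - a) * (df / (f * (1 - f / Nf))))"

text \<open>
  \<open>\<phi> = const\<close> solves the total differential equation \<open>\<omega> = 0\<close> on \<open>U\<close> iff
  \<open>d\<phi>\<close> is a multiple \<open>\<mu> \<omega>\<close>, with a point-dependent multiplier \<open>\<mu>\<close>.
\<close>

definition solves_total ::
    "point set \<Rightarrow> (point \<Rightarrow> point \<Rightarrow> real) \<Rightarrow> (point \<Rightarrow> real) \<Rightarrow> bool" where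
  "solves_total U \<omega> \<phi> \<longleftrightarrow> (\<exists>\<mu>. \<forall>p\<in>U. \<forall>v. differential \<phi> p v = \<mu> p * \<omega> p v)"

definition rect :: "real \<Rightarrow> real \<Rightarrow> (real \<times> real) set" where
  "rect NK NL = {0<..<NK} \<times> {0<..<NL}"

definition dom3 :: "real \<Rightarrow> real \<Rightarrow> real \<Rightarrow> point set" where
  "dom3 NK NL Nf = {0<..<NK} \<times> {0<..<NL} \<times> {0<..<Nf}"

text \<open>
  The open first quadrant without the lines \<open>K = NK\<close> and \<open>L = NL\<close>. On these lines a zero base is
  raised to the power \<open>\<alpha>\<close> or \<open>\<beta>\<close>, which is meaningless unless the exponent is positive, and for a
  positive exponent the production function takes the value \<open>Nf\<close>.
\<close>

definition quadrant :: "real \<Rightarrow> real \<Rightarrow> (real \<times> real) set" where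
  "quadrant NK NL = {(K, L). 0 < K \<and> 0 < L \<and> K \<noteq> NK \<and> L \<noteq> NL}"

definition alpha :: "real \<Rightarrow> real \<Rightarrow> real \<Rightarrow> real" where
  "alpha a b c = (c - b) / (a - b)"

definition beta :: "real \<Rightarrow> real \<Rightarrow> real \<Rightarrow> real" where
  "beta a b c = (a - c) / (a - b)"

definition f5 ::
    "real \<Rightarrow> real \<Rightarrow> real \<Rightarrow> real \<Rightarrow> real \<Rightarrow> real \<Rightarrow> real \<Rightarrow> real \<times> real \<Rightarrow> real" where
  "f5 NK NL Nf a b c C = (\<lambda>(K, L).
     Nf * K powr alpha a b c * L powr beta a b c /
       (C * \<bar>NK - K\<bar> powr alpha a b c * \<bar>NL - L\<bar> powr beta a b c
          + K powr alpha a b c * L powr beta a b c))"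

end

theory Submission
  imports Defs
begin

text \<open>
  Each of the three factors of \<open>D\<close> is straightened by its logit: in the coordinates
  \<open>x = ln (K / (NK - K))\<close>, \<open>y = ln (L / (NL - L))\<close>, \<open>z = ln (f / (Nf - f))\<close> the domain becomes all
  of three-space and the two vector fields become the constant fields \<open>(1, 1, 1)\<close> and \<open>(a, b, c)\<close>.
  They span a constant plane whose annihilator is \<open>(c - b) dx + (a - c) dy + (b - a) dz\<close>, and this is
  the form of the total differential equation. It equals \<open>(b - a) dJ\<close> for
  \<open>J = z - \<alpha> x - \<beta> y\<close>, the first integral. Exponentiating \<open>J = - ln C\<close> and solving for \<open>f\<close>
  gives \<open>f5\<close> with constant \<open>C\<close> (\<open>graph_f5_level_set\<close>); every real level occurs, which is why
  exactly the positive constants appear.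

  The step with content is the converse, that an arbitrary \<open>C1\<close> solution \<open>\<phi>\<close> yields the same
  functions. Two points on the same level surface of \<open>J\<close> differ, in logit coordinates, by a vector of
  the constant plane, so the straight segment between them, carried back to \<open>D\<close> by logistic
  functions, is an integral curve of a constant combination of the two fields. Along it \<open>\<phi>\<close> has
  derivative zero, hence \<open>\<phi>\<close> depends on \<open>J\<close> only
  (\<open>solution_const_on_level_sets\<close>), say \<open>\<phi> = h \<circ> J\<close> on \<open>D\<close>. A zero of \<open>\<phi>\<close> with nonzero
  \<open>f\<close>-derivative is then a simple zero \<open>j0\<close> of \<open>h\<close>, and a simple zero is isolated. The preimage under
  \<open>J\<close> of a small interval around \<open>j0\<close> is therefore a neighbourhood of the entire surface
  \<open>J = j0\<close> in which \<open>\<phi>\<close> vanishes on that surface alone (\<open>solution_near_regular_zero\<close>). The usual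
  implicit function theorem would give this near the given point only.
\<close>

section \<open>Logistic coordinates\<close>

definition logistic :: "real \<Rightarrow> real \<Rightarrow> real" where
  "logistic N x = N / (1 + exp (- x))"

definition logit :: "real \<Rightarrow> real \<Rightarrow> real" where
  "logit N y = ln (y / (N - y))"

lemma logistic_bounds:
  assumes "N > 0"
  shows "0 < logistic N x" "logistic N x < N"
proof -
  have "0 < 1 + exp (- x)" using exp_gt_zero[of "-x"] by linarith
  then show "0 < logistic N x" "logistic N x < N"
    using assms by (auto simp: logistic_def field_simps)
qed

lemma logit_logistic:
  assumes "N > 0"
  shows "logit N (logistic N x) = x"
proof -
  have p: "0 < 1 + exp (- x)" using exp_gt_zero[of "-x"] by linarith
  have "N - logistic N x = N * exp (- x) / (1 + exp (- x))"
    using p by (simp add: logistic_def field_simps)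
  then have "logistic N x / (N - logistic N x) = 1 / exp (- x)"
    using assms p by (simp add: logistic_def)
  then have "logistic N x / (N - logistic N x) = exp x"
    by (simp add: exp_minus field_simps)
  then show ?thesis by (simp add: logit_def)
qed

lemma logistic_logit:
  assumes "0 < y" "y < N"
  shows "logistic N (logit N y) = y"
proof -
  have "exp (- logit N y) = (N - y) / y"
    using assms by (simp add: logit_def exp_minus)
  then have "1 + exp (- logit N y) = N / y" using assms by (simp add: field_simps)
  then show ?thesis using assms by (simp add: logistic_def)
qed

text \<open>The logistic functions solve the growth equation \<open>y' = y (1 - y / N)\<close> of each single factor;
  they are the integral curves out of which those of \<open>X3\<close> and \<open>X4\<close> are composed.\<close>

lemma logistic_deriv:
  assumes "N > 0"
  shows "(logistic N has_real_derivative logistic N x * (1 - logistic N x / N)) (at x)"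
proof -
  have p: "1 + exp (- x) \<noteq> 0" using exp_gt_zero[of "-x"] by linarith
  have "((\<lambda>x. N / (1 + exp (- x))) has_real_derivative
      N * exp (- x) / ((1 + exp (- x)) * (1 + exp (- x)))) (at x)"
    using p by (auto intro!: derivative_eq_intros)
  moreover have "logistic N x * (1 - logistic N x / N) = N * exp (- x) / ((1 + exp (- x)) * (1 + exp (- x)))"
    using p assms by (simp add: logistic_def diff_divide_eq_iff)
  ultimately show ?thesis by (simp add: logistic_def[abs_def])
qed

lemma logit_deriv:
  assumes "0 < y" "y < N"
  shows "(logit N has_real_derivative 1 / (y * (1 - y / N))) (at y)"
proof -
  have "N > 0" "N - y > 0" using assms by auto
  then have "((\<lambda>y. ln y - ln (N - y)) has_real_derivative 1 / y + 1 / (N - y)) (at y)"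
    using assms by (auto intro!: derivative_eq_intros simp: divide_inverse)
  moreover have "1 / y + 1 / (N - y) = 1 / (y * (1 - y / N))"
    using assms by (simp add: divide_simps)
  moreover have "\<forall>\<^sub>F y in nhds y. logit N y = ln y - ln (N - y)"
    by (rule eventually_nhds_in_open[THEN eventually_mono, of "{0<..<N}"])
      (use assms in \<open>auto simp: logit_def ln_div\<close>)
  ultimately show ?thesis by (simp add: DERIV_cong_ev)
qed

section \<open>The differential and the two vector fields\<close>

text \<open>The operators \<open>partial_K\<close>, \<open>partial_L\<close>, \<open>partial_f\<close> are one-variable derivatives along the axes;
  this identifies the form assembled from them with the total derivative, so that the chain rule
  becomes available for \<open>differential\<close>.\<close>

lemma differential_eq:
  assumes "(\<phi> has_derivative \<phi>') (at p)"
  shows "differential \<phi> p v = \<phi>' v"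
proof -
  obtain K L f where p: "p = (K, L, f)" by (cases p)
  obtain u w z where v: "v = (u, w, z)" by (cases v)
  interpret bounded_linear \<phi>' using assms by (rule has_derivative_bounded_linear)
  have smult: "\<phi>' (r * x, r * y, r * z) = \<phi>' (x, y, z) * r" for r x y z
    using scaleR[of r "(x, y, z)"] by (simp add: mult.commute)
  have "((\<lambda>x. \<phi> (x, L, f)) has_derivative (\<lambda>h. \<phi>' (h, 0, 0))) (at K)"
    by (rule has_derivative_compose[where f = "\<lambda>x. (x, L, f)" and f' = "\<lambda>h. (h, 0, 0)"])
      (intro has_derivative_Pair has_derivative_ident has_derivative_const, use assms p in simp)
  moreover have "(\<lambda>h. \<phi>' (h, 0, 0)) = (*) (\<phi>' (1, 0, 0))"
  proof
    show "\<phi>' (h, 0, 0) = \<phi>' (1, 0, 0) * h" for h using smult[of h 1 0 0] by simp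
  qed
  ultimately have 1: "deriv (\<lambda>x. \<phi> (x, L, f)) K = \<phi>' (1, 0, 0)"
    by (intro DERIV_imp_deriv) (simp only: has_field_derivative_def)
  have "((\<lambda>x. \<phi> (K, x, f)) has_derivative (\<lambda>h. \<phi>' (0, h, 0))) (at L)"
    by (rule has_derivative_compose[where f = "\<lambda>x. (K, x, f)" and f' = "\<lambda>h. (0, h, 0)"])
      (intro has_derivative_Pair has_derivative_ident has_derivative_const, use assms p in simp)
  moreover have "(\<lambda>h. \<phi>' (0, h, 0)) = (*) (\<phi>' (0, 1, 0))"
  proof
    show "\<phi>' (0, h, 0) = \<phi>' (0, 1, 0) * h" for h using smult[of h 0 1 0] by simp
  qed
  ultimately have 2: "deriv (\<lambda>x. \<phi> (K, x, f)) L = \<phi>' (0, 1, 0)"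
    by (intro DERIV_imp_deriv) (simp only: has_field_derivative_def)
  have "((\<lambda>x. \<phi> (K, L, x)) has_derivative (\<lambda>h. \<phi>' (0, 0, h))) (at f)"
    by (rule has_derivative_compose[where f = "\<lambda>x. (K, L, x)" and f' = "\<lambda>h. (0, 0, h)"])
      (intro has_derivative_Pair has_derivative_ident has_derivative_const, use assms p in simp)
  moreover have "(\<lambda>h. \<phi>' (0, 0, h)) = (*) (\<phi>' (0, 0, 1))"
  proof
    show "\<phi>' (0, 0, h) = \<phi>' (0, 0, 1) * h" for h using smult[of h 0 0 1] by simp
  qed
  ultimately have 3: "deriv (\<lambda>x. \<phi> (K, L, x)) f = \<phi>' (0, 0, 1)"
    by (intro DERIV_imp_deriv) (simp only: has_field_derivative_def)
  have "\<phi>' v = \<phi>' (u, 0, 0) + \<phi>' (0, w, 0) + \<phi>' (0, 0, z)"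
    by (simp only: v flip: add) simp
  also have "\<dots> = \<phi>' (1, 0, 0) * u + \<phi>' (0, 1, 0) * w + \<phi>' (0, 0, 1) * z"
    using smult[of u 1 0 0] smult[of w 0 1 0] smult[of z 0 0 1] by simp
  finally show ?thesis
    by (simp add: differential_def partial_K_def partial_L_def partial_f_def p v 1 2 3)
qed

lemma partials_eq_differential:
  "partial_K \<phi> p = differential \<phi> p (1, 0, 0)"
  "partial_L \<phi> p = differential \<phi> p (0, 1, 0)"
  "partial_f \<phi> p = differential \<phi> p (0, 0, 1)"
  by (simp_all add: differential_def)

lemma open_dom3: "open (dom3 NK NL Nf)"
  unfolding dom3_def by (intro open_Times) auto

lemma C1_on_has_derivative:
  assumes "C1_on U \<phi>" "open U" "p \<in> U"
  shows "(\<phi> has_derivative differential \<phi> p) (at p)"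
proof -
  have "\<phi> differentiable (at p)"
    using assms differentiable_on_eq_differentiable_at unfolding C1_on_def by blast
  then obtain \<phi>' where d: "(\<phi> has_derivative \<phi>') (at p)" by (auto simp: differentiable_def)
  then have "differential \<phi> p = \<phi>'" using differential_eq by blast
  then show ?thesis using d by simp
qed

lemma lie_bracket_X3_X4: "lie_bracket (X3 NK NL Nf) (X4 NK NL Nf a b c) p = 0"
proof -
  obtain K L f where p: "p = (K, L, f)" by (cases p)
  have d: "deriv (\<lambda>x. m * x * (1 - x / N)) y = m * (1 - 2 * y / N)" for m N y :: real
    by (rule DERIV_imp_deriv, cases "N = 0")
      (auto intro!: derivative_eq_intros simp: algebra_simps)
  have d1: "deriv (\<lambda>x. x * (1 - x / N)) y = 1 - 2 * y / N" for N y :: real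
    using d[of 1] by simp
  show ?thesis
    by (simp add: lie_bracket_def vf_apply_def differential_def partial_K_def partial_L_def
        partial_f_def X3_def X4_def p d d1 zero_prod_def)
qed

lemma logistic_rate_pos:
  assumes "(K, L, f) \<in> dom3 NK NL Nf"
  shows "0 < K * (1 - K / NK)" "0 < L * (1 - L / NL)" "0 < f * (1 - f / Nf)"
  using assms by (auto simp: dom3_def)

lemma X3_X4_independent:
  assumes "p \<in> dom3 NK NL Nf" "a \<noteq> b"
    and "s *\<^sub>R X3 NK NL Nf p + t *\<^sub>R X4 NK NL Nf a b c p = 0"
  shows "s = 0 \<and> t = 0"
proof -
  obtain K L f where p: "p = (K, L, f)" by (cases p)
  note r = logistic_rate_pos[OF assms(1)[unfolded p]]
  have "(s + t * a) * (K * (1 - K / NK)) = 0" "(s + t * b) * (L * (1 - L / NL)) = 0"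
    using assms(3) by (simp_all only: p X3_def X4_def zero_prod_def case_prod_conv scaleR_Pair
        add_Pair real_scaleR_def prod.inject distrib_right mult.assoc)
  then have "s + t * a = 0" "s + t * b = 0" using r by auto
  then have "t * (a - b) = 0" unfolding right_diff_distrib by linarith
  then show ?thesis using \<open>a \<noteq> b\<close> \<open>s + t * a = 0\<close> by auto
qed

lemma total_form_X3_X4:
  assumes "p \<in> dom3 NK NL Nf"
  shows "total_form NK NL Nf a b c p (s *\<^sub>R X3 NK NL Nf p + t *\<^sub>R X4 NK NL Nf a b c p) = 0"
proof -
  obtain K L f where p: "p = (K, L, f)" by (cases p)
  note r = logistic_rate_pos[OF assms[unfolded p]]
  have e: "(s * (y * z) + t * (m * y * z)) / (y * z) = s + t * m" if "0 < y * z" for y z m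
  proof -
    have "s * (y * z) + t * (m * y * z) = (s + t * m) * (y * z)" by (simp add: algebra_simps)
    then show ?thesis
      by (simp only: nonzero_mult_div_cancel_right[OF less_imp_neq[OF that, symmetric]])
  qed
  have "total_form NK NL Nf a b c p (s *\<^sub>R X3 NK NL Nf p + t *\<^sub>R X4 NK NL Nf a b c p)
      = (c - b) * (s + t * a) + (a - c) * (s + t * b) + (b - a) * (s + t * c)"
    unfolding p X3_def X4_def total_form_def by (simp only: case_prod_conv scaleR_Pair add_Pair real_scaleR_def e[OF r(1)] e[OF r(2)] e[OF r(3)])
  then show ?thesis by (simp add: algebra_simps)
qed

text \<open>After division by the logistic rates, the two fields are \<open>(1, 1, 1)\<close> and \<open>(a, b, c)\<close>. The
  first two components of a vector determine its coefficients \<open>s\<close>, \<open>t\<close> because \<open>a \<noteq> b\<close>, and the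
  equation of the kernel forces the third component to agree.\<close>

lemma kernel_total_form:
  assumes "p \<in> dom3 NK NL Nf" "a \<noteq> b"
  shows "total_form NK NL Nf a b c p v = 0 \<longleftrightarrow>
    (\<exists>s t. v = s *\<^sub>R X3 NK NL Nf p + t *\<^sub>R X4 NK NL Nf a b c p)"
proof
  assume w: "total_form NK NL Nf a b c p v = 0"
  obtain K L f where p: "p = (K, L, f)" by (cases p)
  obtain dK dL df where v: "v = (dK, dL, df)" by (cases v)
  note r = logistic_rate_pos[OF assms(1)[unfolded p]]
  define x y z where "x = dK / (K * (1 - K / NK))" and "y = dL / (L * (1 - L / NL))"
    and "z = df / (f * (1 - f / Nf))"
  have dK: "dK = x * (K * (1 - K / NK))" and dL: "dL = y * (L * (1 - L / NL))"
    and df: "df = z * (f * (1 - f / Nf))"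
    unfolding x_def y_def z_def
    using r[THEN less_imp_neq, symmetric]
    by (simp_all only: times_divide_eq_left nonzero_mult_div_cancel_right not_False_eq_True)
  have lin: "(c - b) * x + (a - c) * y + (b - a) * z = 0"
    using w by (simp add: p v total_form_def x_def y_def z_def)
  define t s where "t = (x - y) / (a - b)" and "s = x - t * a"
  have t: "t * (a - b) = x - y" using \<open>a \<noteq> b\<close> by (simp add: t_def)
  have x: "x = s + t * a" by (simp add: s_def)
  have y: "y = s + t * b" using t by (simp add: s_def algebra_simps)
  have "(b - a) * z = (b - a) * (s + t * c)"
    using lin unfolding x y by (simp add: algebra_simps)
  then have z: "z = s + t * c" using \<open>a \<noteq> b\<close> by simp
  have "v = s *\<^sub>R X3 NK NL Nf p + t *\<^sub>R X4 NK NL Nf a b c p"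
    unfolding p v dK dL df x y z X3_def X4_def by (simp add: distrib_right mult.assoc)
  then show "\<exists>s t. v = s *\<^sub>R X3 NK NL Nf p + t *\<^sub>R X4 NK NL Nf a b c p" by blast
qed (use total_form_X3_X4[OF assms(1)] in blast)

lemma linear_differential: "linear (differential \<phi> p)"
  by (rule linearI) (auto simp: differential_def algebra_simps)

lemma linear_total_form: "linear (total_form NK NL Nf a b c p)"
  by (rule linearI)
    (auto simp: total_form_def add_divide_distrib distrib_left mult.left_commute
      simp flip: times_divide_eq_right split: prod.splits)

text \<open>If \<open>d\<phi>\<close> annihilates both fields, its kernel contains that of the total form, so one linear form
  is a multiple of the other; the multiplier is read off from the \<open>f\<close>-direction, which is transversal
  to the kernel.\<close>

lemma solutions_iff_solves_total:
  assumes "a \<noteq> b"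
  shows "(\<forall>p\<in>dom3 NK NL Nf. vf_apply (X3 NK NL Nf) \<phi> p = 0 \<and> vf_apply (X4 NK NL Nf a b c) \<phi> p = 0)
    \<longleftrightarrow> solves_total (dom3 NK NL Nf) (total_form NK NL Nf a b c) \<phi>"
    (is "?L \<longleftrightarrow> ?R")
proof
  assume ?L
  define \<mu> where "\<mu> p = (case p of (K, L, f) \<Rightarrow> partial_f \<phi> p * (f * (1 - f / Nf)) / (b - a))" for p
  have "differential \<phi> p v = \<mu> p * total_form NK NL Nf a b c p v"
    if pD: "p \<in> dom3 NK NL Nf" for p v
  proof -
    obtain K L f where p: "p = (K, L, f)" by (cases p)
    note r = logistic_rate_pos[OF pD[unfolded p]]
    interpret d: linear "differential \<phi> p" by (rule linear_differential)
    interpret w: linear "total_form NK NL Nf a b c p" by (rule linear_total_form)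
    define G where "G = f * (1 - f / Nf)"
    \<comment> \<open>\<open>(0, 0, e)\<close> is the projection of \<open>v\<close> to the \<open>f\<close>-axis along the kernel of the form\<close>
    define e where "e = total_form NK NL Nf a b c p v * G / (b - a)"
    have e: "total_form NK NL Nf a b c p (0, 0, e) = total_form NK NL Nf a b c p v"
    proof -
      have "total_form NK NL Nf a b c p (0, 0, e) = (b - a) * (e / G)"
        by (simp add: p total_form_def G_def)
      also have "\<dots> = total_form NK NL Nf a b c p v"
        using r(3)[folded G_def] assms by (simp add: e_def)
      finally show ?thesis .
    qed
    have "total_form NK NL Nf a b c p (v - (0, 0, e)) = 0" by (simp only: w.diff e diff_self)
    then obtain s t where st: "v - (0, 0, e) = s *\<^sub>R X3 NK NL Nf p + t *\<^sub>R X4 NK NL Nf a b c p"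
      using kernel_total_form[OF pD assms] by blast
    have "differential \<phi> p (v - (0, 0, e)) = 0"
      unfolding st d.add d.scale using \<open>?L\<close> pD by (simp add: vf_apply_def)
    then have "differential \<phi> p v = differential \<phi> p (0, 0, e)" by (simp add: d.diff)
    also have "\<dots> = \<mu> p * total_form NK NL Nf a b c p v"
      by (simp add: differential_def \<mu>_def p e_def G_def)
    finally show ?thesis .
  qed
  then show ?R unfolding solves_total_def by blast
next
  assume ?R
  then obtain \<mu> where "\<And>p v. p \<in> dom3 NK NL Nf \<Longrightarrow>
      differential \<phi> p v = \<mu> p * total_form NK NL Nf a b c p v"
    unfolding solves_total_def by blast
  moreover have "total_form NK NL Nf a b c p (X3 NK NL Nf p) = 0"
      "total_form NK NL Nf a b c p (X4 NK NL Nf a b c p) = 0"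
    if "p \<in> dom3 NK NL Nf" for p
    using total_form_X3_X4[OF that, of a b c 1 0] total_form_X3_X4[OF that, of a b c 0 1]
    by simp_all
  ultimately show ?L by (simp add: vf_apply_def)
qed

section \<open>The first integral\<close>

text \<open>The normalisation with coefficient 1 at \<open>logit Nf f\<close> makes \<open>- ln C\<close> the value of the integral
  on the graph of \<open>f5\<close> with constant \<open>C\<close>.\<close>

definition first_integral ::
    "real \<Rightarrow> real \<Rightarrow> real \<Rightarrow> real \<Rightarrow> real \<Rightarrow> real \<Rightarrow> point \<Rightarrow> real" where
  "first_integral NK NL Nf a b c = (\<lambda>(K, L, f).
     logit Nf f - alpha a b c * logit NK K - beta a b c * logit NL L)"

lemma alpha_beta:
  assumes "a \<noteq> b"
  shows "alpha a b c + beta a b c = 1" "alpha a b c * a + beta a b c * b = c"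
    "alpha a b c * (a - b) = c - b" "beta a b c * (a - b) = a - c"
proof -
  have n: "a - b \<noteq> 0" using assms by simp
  then show 1: "alpha a b c * (a - b) = c - b" "beta a b c * (a - b) = a - c"
    by (simp_all add: alpha_def beta_def)
  show "alpha a b c + beta a b c = 1"
    using n by (simp add: alpha_def beta_def add_divide_distrib[symmetric])
  moreover have "alpha a b c * a + beta a b c * b
      = alpha a b c * (a - b) + (alpha a b c + beta a b c) * b"
    by (simp add: algebra_simps)
  ultimately show "alpha a b c * a + beta a b c * b = c" using 1(1) by simp
qed

lemma first_integral_has_derivative:
  assumes "p \<in> dom3 NK NL Nf" "a \<noteq> b"
  shows "((\<lambda>q. (b - a) * (first_integral NK NL Nf a b c q + d)) has_derivative
    total_form NK NL Nf a b c p) (at p)"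
proof -
  obtain K L f where p: "p = (K, L, f)" by (cases p)
  have dom: "0 < K" "K < NK" "0 < L" "L < NL" "0 < f" "f < Nf"
    using assms(1) by (auto simp: p dom3_def)
  note c = DERIV_compose_FDERIV
  have 1: "((\<lambda>q::point. logit NK (fst q)) has_derivative (\<lambda>v. fst v * (1 / (K * (1 - K / NK))))) (at p)"
    by (rule c[where f = "logit NK" and g = fst]) (use logit_deriv dom in \<open>auto simp: p intro!: derivative_eq_intros\<close>)
  have 2: "((\<lambda>q::point. logit NL (fst (snd q))) has_derivative
      (\<lambda>v. fst (snd v) * (1 / (L * (1 - L / NL))))) (at p)"
    by (rule c[where f = "logit NL" and g = "\<lambda>q. fst (snd q)"])
      (use logit_deriv dom in \<open>auto simp: p intro!: derivative_eq_intros\<close>)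
  have 3: "((\<lambda>q::point. logit Nf (snd (snd q))) has_derivative
      (\<lambda>v. snd (snd v) * (1 / (f * (1 - f / Nf))))) (at p)"
    by (rule c[where f = "logit Nf" and g = "\<lambda>q. snd (snd q)"])
      (use logit_deriv dom in \<open>auto simp: p intro!: derivative_eq_intros\<close>)
  have J: "((\<lambda>q. (b - a) * (first_integral NK NL Nf a b c q + d)) has_derivative
    (\<lambda>v. (b - a) * (snd (snd v) * (1 / (f * (1 - f / Nf)))
       - alpha a b c * (fst v * (1 / (K * (1 - K / NK))))
       - beta a b c * (fst (snd v) * (1 / (L * (1 - L / NL))))))) (at p)"
    unfolding first_integral_def case_prod_unfold
    by (auto intro!: derivative_eq_intros 1 2 3)
  have "c - b = - alpha a b c * (b - a)" "a - c = - beta a b c * (b - a)"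
    using alpha_beta(3,4)[OF assms(2), of c] by (simp_all add: algebra_simps)
  then have eq: "(c - b) * (x / X) + (a - c) * (y / Y) + (b - a) * (z / Z)
      = (b - a) * (z * (1 / Z) - alpha a b c * (x * (1 / X)) - beta a b c * (y * (1 / Y)))"
    for x y z X Y Z
    by (simp add: right_diff_distrib mult_ac)
  have form: "total_form NK NL Nf a b c p = (\<lambda>v. (b - a) * (snd (snd v) * (1 / (f * (1 - f / Nf)))
       - alpha a b c * (fst v * (1 / (K * (1 - K / NK))))
       - beta a b c * (fst (snd v) * (1 / (L * (1 - L / NL))))))"
    by (simp only: total_form_def p case_prod_conv case_prod_unfold eq fst_conv snd_conv)
  show ?thesis using J unfolding form .
qed

lemma first_integral_solution:
  fixes NK NL Nf a b c d :: real
  assumes "a \<noteq> b"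
  defines "\<phi> \<equiv> \<lambda>q. (b - a) * (first_integral NK NL Nf a b c q + d)"
    and "D \<equiv> dom3 NK NL Nf"
  shows "p \<in> D \<Longrightarrow> differential \<phi> p = total_form NK NL Nf a b c p"
    and "C1_on D \<phi>"
    and "p \<in> D \<Longrightarrow> vf_apply (X3 NK NL Nf) \<phi> p = 0"
    and "p \<in> D \<Longrightarrow> vf_apply (X4 NK NL Nf a b c) \<phi> p = 0"
    and "p \<in> D \<Longrightarrow> partial_f \<phi> p \<noteq> 0"
proof -
  have der: "(\<phi> has_derivative total_form NK NL Nf a b c p) (at p)" if "p \<in> D" for p
    using first_integral_has_derivative that assms by blast
  show diff: "differential \<phi> p = total_form NK NL Nf a b c p" if "p \<in> D" for p
    using differential_eq[OF der[OF that]] by blast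
  have "solves_total D (total_form NK NL Nf a b c) \<phi>"
    unfolding solves_total_def by (rule exI[of _ "\<lambda>_. 1"]) (simp add: diff)
  then show "vf_apply (X3 NK NL Nf) \<phi> p = 0" "vf_apply (X4 NK NL Nf a b c) \<phi> p = 0" if "p \<in> D" for p
    using solutions_iff_solves_total[OF assms(1)] that unfolding D_def by blast+
  show "partial_f \<phi> p \<noteq> 0" if "p \<in> D" for p
  proof -
    obtain K L f where p: "p = (K, L, f)" by (cases p)
    have "0 < f * (1 - f / Nf)" using logistic_rate_pos that by (auto simp: p D_def)
    moreover have "partial_f \<phi> p = (b - a) * (1 / (f * (1 - f / Nf)))"
      unfolding partials_eq_differential diff[OF that] by (simp add: p total_form_def)
    ultimately show ?thesis
      using assms(1) by (metis divide_eq_0_iff eq_iff_diff_eq_0 less_irrefl mult_eq_0_iff zero_neq_one)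
  qed
  have rates: "fst q * (1 - fst q / NK) \<noteq> 0" "fst (snd q) * (1 - fst (snd q) / NL) \<noteq> 0"
    "snd (snd q) * (1 - snd (snd q) / Nf) \<noteq> 0" if "q \<in> D" for q
    using logistic_rate_pos[of "fst q" "fst (snd q)" "snd (snd q)" NK NL Nf,
        THEN less_imp_neq, symmetric] that
    by (simp_all only: D_def prod.collapse not_False_eq_True)
  have N: "NK \<noteq> 0 \<and> NL \<noteq> 0 \<and> Nf \<noteq> 0" if "q \<in> D" for q
    using that by (auto simp: D_def dom3_def)
  have "continuous_on D (partial_K \<phi>) \<longleftrightarrow> continuous_on D (\<lambda>q. (c - b) * (1 / (fst q * (1 - fst q / NK))))"
    by (rule continuous_on_cong)
      (auto simp: partials_eq_differential diff total_form_def)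
  moreover have "continuous_on D (partial_L \<phi>) \<longleftrightarrow>
      continuous_on D (\<lambda>q. (a - c) * (1 / (fst (snd q) * (1 - fst (snd q) / NL))))"
    by (rule continuous_on_cong)
      (auto simp: partials_eq_differential diff total_form_def)
  moreover have "continuous_on D (partial_f \<phi>) \<longleftrightarrow>
      continuous_on D (\<lambda>q. (b - a) * (1 / (snd (snd q) * (1 - snd (snd q) / Nf))))"
    by (rule continuous_on_cong)
      (auto simp: partials_eq_differential diff total_form_def)
  moreover have "\<phi> differentiable_on D"
    unfolding differentiable_on_def differentiable_def using der has_derivative_at_withinI by blast
  moreover have "continuous_on D (\<lambda>q. (c - b) * (1 / (fst q * (1 - fst q / NK))))"
    "continuous_on D (\<lambda>q. (a - c) * (1 / (fst (snd q) * (1 - fst (snd q) / NL))))"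
    "continuous_on D (\<lambda>q. (b - a) * (1 / (snd (snd q) * (1 - snd (snd q) / Nf))))"
    by (intro continuous_intros; use rates N in blast)+
  ultimately show "C1_on D \<phi>" by (simp add: C1_on_def)
qed

lemma integrable_X3_X4:
  assumes "a \<noteq> b"
  shows "integrable_distribution (dom3 NK NL Nf) (X3 NK NL Nf) (X4 NK NL Nf a b c)"
proof -
  define \<phi> where "\<phi> = (\<lambda>q. (b - a) * (first_integral NK NL Nf a b c q + 0))"
  note sol = first_integral_solution[OF assms, where NK = NK and NL = NL and Nf = Nf and c = c and d = 0, folded \<phi>_def]
  have "(\<exists>v. differential \<phi> q v \<noteq> 0) \<and> vf_apply (X3 NK NL Nf) \<phi> q = 0
      \<and> vf_apply (X4 NK NL Nf a b c) \<phi> q = 0" if "q \<in> dom3 NK NL Nf" for q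
    using sol(3-5)[OF that] partials_eq_differential(3)[of \<phi> q] by auto
  then show ?thesis
    unfolding integrable_distribution_def
    using X3_X4_independent assms open_dom3 sol(2) by (metis subset_refl)
qed

section \<open>Solutions are functions of the first integral\<close>

text \<open>A level surface of the first integral is connected by single orbits of constant combinations
  \<open>\<sigma> X3 + \<tau> X4\<close>: in logit coordinates it is an affine plane and these orbits are its straight lines.\<close>

lemma solution_const_on_level_sets:
  assumes pos: "NK > 0" "NL > 0" "Nf > 0" and ab: "a \<noteq> b" and C1: "C1_on (dom3 NK NL Nf) \<phi>"
    and sol: "\<And>p. p \<in> dom3 NK NL Nf \<Longrightarrow>
      vf_apply (X3 NK NL Nf) \<phi> p = 0 \<and> vf_apply (X4 NK NL Nf a b c) \<phi> p = 0"
    and pq: "p \<in> dom3 NK NL Nf" "q \<in> dom3 NK NL Nf"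
    and level: "first_integral NK NL Nf a b c p = first_integral NK NL Nf a b c q"
  shows "\<phi> p = \<phi> q"
proof -
  obtain K L f where p: "p = (K, L, f)" by (cases p)
  obtain K' L' f' where q: "q = (K', L', f')" by (cases q)
  define x y z where "x = logit NK K" and "y = logit NL L" and "z = logit Nf f"
  define u v w where "u = logit NK K' - x" and "v = logit NL L' - y" and "w = logit Nf f' - z"
  define \<gamma> where "\<gamma> t = (logistic NK (x + t * u), logistic NL (y + t * v), logistic Nf (z + t * w))"
    for t
  have dom: "0 < K" "K < NK" "0 < L" "L < NL" "0 < f" "f < Nf"
    "0 < K'" "K' < NK" "0 < L'" "L' < NL" "0 < f'" "f' < Nf"
    using pq by (auto simp: p q dom3_def)
  have \<gamma>0: "\<gamma> 0 = p" and \<gamma>1: "\<gamma> 1 = q"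
    using dom by (simp_all add: \<gamma>_def p q x_def y_def z_def u_def v_def w_def logistic_logit)
  have \<gamma>D: "\<gamma> t \<in> dom3 NK NL Nf" for t
    using logistic_bounds pos by (auto simp: \<gamma>_def dom3_def)
  have w: "w = alpha a b c * u + beta a b c * v"
    using level by (simp add: p q first_integral_def x_def y_def z_def u_def v_def w_def algebra_simps)
  \<comment> \<open>the difference vector is \<open>\<sigma> (1, 1, 1) + \<tau> (a, b, c)\<close>; its third component fits because of \<open>level\<close>\<close>
  define \<tau> \<sigma> where "\<tau> = (u - v) / (a - b)" and "\<sigma> = u - \<tau> * a"
  have "\<tau> * (a - b) = u - v" using ab by (simp add: \<tau>_def)
  then have u': "u = \<sigma> + \<tau> * a" and v': "v = \<sigma> + \<tau> * b"
    by (simp_all add: \<sigma>_def algebra_simps)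
  have "w = (alpha a b c + beta a b c) * \<sigma> + (alpha a b c * a + beta a b c * b) * \<tau>"
    unfolding w u' v' by (simp add: algebra_simps)
  then have w': "w = \<sigma> + \<tau> * c"
    using alpha_beta(1,2)[OF ab, of c] by simp
  have "((\<lambda>t. \<phi> (\<gamma> t)) has_derivative (\<lambda>h. 0)) (at t)" for t
  proof -
    have aux: "((\<lambda>t. logistic N (x + t * u)) has_derivative
        (\<lambda>h. h * (u * (logistic N (x + t * u) * (1 - logistic N (x + t * u) / N))))) (at t)"
      if "N > 0" for N x u
    proof -
      have "((\<lambda>t. logistic N (x + t * u)) has_real_derivative
          logistic N (x + t * u) * (1 - logistic N (x + t * u) / N) * u) (at t)"
        by (rule DERIV_chain2[OF logistic_deriv[OF that]]) (auto intro!: derivative_eq_intros)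
      moreover have "(\<lambda>h. h * (u * (logistic N (x + t * u) * (1 - logistic N (x + t * u) / N))))
          = (*) (logistic N (x + t * u) * (1 - logistic N (x + t * u) / N) * u)"
        by (simp add: fun_eq_iff mult_ac)
      ultimately show ?thesis by (simp only: has_field_derivative_def)
    qed
    let ?V = "\<sigma> *\<^sub>R X3 NK NL Nf (\<gamma> t) + \<tau> *\<^sub>R X4 NK NL Nf a b c (\<gamma> t)"
    have V: "?V = (u * (logistic NK (x + t * u) * (1 - logistic NK (x + t * u) / NK)),
        v * (logistic NL (y + t * v) * (1 - logistic NL (y + t * v) / NL)),
        w * (logistic Nf (z + t * w) * (1 - logistic Nf (z + t * w) / Nf)))"
      unfolding \<gamma>_def X3_def X4_def by (simp add: u' v' w' distrib_right mult.assoc)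
    have \<gamma>': "(\<gamma> has_derivative (\<lambda>h. h *\<^sub>R ?V)) (at t)"
      unfolding V scaleR_Pair real_scaleR_def unfolding \<gamma>_def
      by (intro has_derivative_Pair aux pos)
    interpret d: linear "differential \<phi> (\<gamma> t)" by (rule linear_differential)
    have "differential \<phi> (\<gamma> t) (h *\<^sub>R ?V) = 0" for h
      unfolding d.add d.scale using sol[OF \<gamma>D[of t]] by (simp add: vf_apply_def)
    then show ?thesis
      using has_derivative_compose[OF \<gamma>' C1_on_has_derivative[OF C1 open_dom3 \<gamma>D]] by simp
  qed
  then have "\<exists>k. \<forall>t\<in>UNIV. \<phi> (\<gamma> t) = k"
    by (intro has_derivative_zero_constant) auto
  then have "\<phi> (\<gamma> 0) = \<phi> (\<gamma> 1)" by fastforce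
  then show ?thesis by (simp add: \<gamma>0 \<gamma>1)
qed

section \<open>The production function\<close>

lemma f5_logistic:
  assumes "(K, L) \<in> rect NK NL" "C > 0"
  shows "f5 NK NL Nf a b c C (K, L)
    = logistic Nf (alpha a b c * logit NK K + beta a b c * logit NL L - ln C)"
proof -
  let ?\<alpha> = "alpha a b c" and ?\<beta> = "beta a b c"
  have dom: "0 < K" "K < NK" "0 < L" "L < NL" using assms(1) by (auto simp: rect_def)
  have powr: "exp (m * logit N y) = y powr m / (N - y) powr m" if "0 < y" "y < N" for m N y
    using that by (simp add: logit_def powr_def ln_div right_diff_distrib exp_diff)
  define A B where "A = K powr ?\<alpha> * L powr ?\<beta>" and "B = (NK - K) powr ?\<alpha> * (NL - L) powr ?\<beta>"
  have A: "A > 0" using dom by (simp add: A_def)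
  have "exp (- (?\<alpha> * logit NK K + ?\<beta> * logit NL L - ln C))
      = C / (exp (?\<alpha> * logit NK K) * exp (?\<beta> * logit NL L))"
    using assms(2) by (simp add: exp_diff exp_add exp_minus)
  also have "\<dots> = C * B / A"
    using dom by (simp add: powr A_def B_def)
  finally have "logistic Nf (?\<alpha> * logit NK K + ?\<beta> * logit NL L - ln C) = Nf / (1 + C * B / A)"
    by (simp only: logistic_def)
  also have "1 + C * B / A = (C * B + A) / A" using A by (simp add: add_divide_distrib)
  also have "Nf / ((C * B + A) / A) = f5 NK NL Nf a b c C (K, L)"
    using dom by (simp add: f5_def A_def B_def mult.assoc)
  finally show ?thesis ..
qed

text \<open>Since the logit inverts the logistic function, the graph of \<open>f5\<close> over the rectangle is a full
  level surface of the first integral.\<close>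

lemma graph_f5_level_set:
  assumes "(K, L, f) \<in> dom3 NK NL Nf" "C > 0"
  shows "f = f5 NK NL Nf a b c C (K, L) \<longleftrightarrow> first_integral NK NL Nf a b c (K, L, f) = - ln C"
proof -
  have dom: "(K, L) \<in> rect NK NL" "0 < f" "f < Nf"
    using assms(1) by (auto simp: dom3_def rect_def)
  let ?z = "alpha a b c * logit NK K + beta a b c * logit NL L - ln C"
  have "f = f5 NK NL Nf a b c C (K, L) \<longleftrightarrow> f = logistic Nf ?z"
    by (simp add: f5_logistic dom assms(2))
  also have "\<dots> \<longleftrightarrow> logit Nf f = ?z"
    using logit_logistic logistic_logit[of f Nf] dom by (metis order_less_trans)
  also have "\<dots> \<longleftrightarrow> first_integral NK NL Nf a b c (K, L, f) = - ln C"
    by (auto simp: first_integral_def)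
  finally show ?thesis .
qed

lemma graph_f5_in_dom3:
  assumes "(K, L) \<in> rect NK NL" "C > 0" "Nf > 0"
  shows "(K, L, f5 NK NL Nf a b c C (K, L)) \<in> dom3 NK NL Nf"
  using assms logistic_bounds[OF assms(3)] by (auto simp: f5_logistic dom3_def rect_def)

text \<open>The solution is written as \<open>h \<circ> J\<close>, where \<open>h\<close> is \<open>\<phi>\<close> on the vertical line through the given
  zero, parametrised by the value of \<open>J\<close>. The same \<open>h\<close> is obtained on every vertical line, so its
  nonzero derivative at \<open>j0\<close> controls \<open>partial_f \<phi>\<close> along the whole graph. Uniqueness of the constant
  is forced by the given point, which lies on the graph of one \<open>f5\<close> only.\<close>

lemma solution_near_regular_zero:
  fixes NK NL Nf a b c :: real
  assumes pos: "NK > 0" "NL > 0" "Nf > 0" and ab: "a \<noteq> b" and C1: "C1_on (dom3 NK NL Nf) \<phi>"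
    and sol: "\<And>p. p \<in> dom3 NK NL Nf \<Longrightarrow>
      vf_apply (X3 NK NL Nf) \<phi> p = 0 \<and> vf_apply (X4 NK NL Nf a b c) \<phi> p = 0"
    and p0: "(K0, L0, f0) \<in> dom3 NK NL Nf" "\<phi> (K0, L0, f0) = 0" "partial_f \<phi> (K0, L0, f0) \<noteq> 0"
  defines "D \<equiv> dom3 NK NL Nf" and "F \<equiv> f5 NK NL Nf a b c"
  shows "\<exists>!C. C > 0 \<and> (\<exists>V. open V \<and> V \<subseteq> D \<and> (K0, L0, f0) \<in> V
              \<and> (\<forall>(K, L)\<in>rect NK NL. (K, L, F C (K, L)) \<in> V \<and> partial_f \<phi> (K, L, F C (K, L)) \<noteq> 0)
              \<and> (\<forall>K L f. (K, L, f) \<in> V \<longrightarrow> (\<phi> (K, L, f) = 0 \<longleftrightarrow> f = F C (K, L))))"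
proof -
  define J where "J = first_integral NK NL Nf a b c"
  define j0 where "j0 = J (K0, L0, f0)"
  define C where "C = exp (- j0)"
  have C: "C > 0" "- ln C = j0" by (simp_all add: C_def)
  \<comment> \<open>the logit of the height at which the vertical line over \<open>(K, L)\<close> meets the level \<open>J = j\<close>\<close>
  define z where "z K L j = j + alpha a b c * logit NK K + beta a b c * logit NL L" for K L j
  define h where "h j = \<phi> (K0, L0, logistic Nf (z K0 L0 j))" for j
  have J_logistic: "J (K, L, logistic Nf (z K L j)) = j" for K L j
    using pos by (simp add: J_def first_integral_def z_def logit_logistic)
  have D_logistic: "(K, L, logistic Nf s) \<in> D" if "(K, L) \<in> rect NK NL" for K L s
    using that logistic_bounds[OF pos(3)] by (auto simp: D_def dom3_def rect_def)
  have rect0: "(K0, L0) \<in> rect NK NL" using p0(1) by (auto simp: dom3_def rect_def)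
  have factor: "\<phi> p = h (J p)" if "p \<in> D" for p
    unfolding h_def
    by (rule solution_const_on_level_sets[OF pos ab C1 sol])
      (use that D_logistic[OF rect0] J_logistic in \<open>auto simp: D_def J_def\<close>)
  have J0: "z K0 L0 j0 = logit Nf f0" by (simp add: z_def j0_def J_def first_integral_def)
  have p0D: "(K0, L0, f0) \<in> D" using p0 by (simp add: D_def)
  have f_deriv: "((\<lambda>x. \<phi> (K, L, x)) has_real_derivative partial_f \<phi> (K, L, f)) (at f)"
    if "(K, L, f) \<in> D" for K L f
  proof -
    have "((\<lambda>x. \<phi> (K, L, x)) has_derivative (\<lambda>h. differential \<phi> (K, L, f) (0, 0, h))) (at f)"
      by (rule has_derivative_compose[of "\<lambda>x. (K, L, x)" _ f UNIV \<phi>, simplified])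
        (intro has_derivative_Pair has_derivative_ident has_derivative_const,
          use C1_on_has_derivative[OF C1 open_dom3] that in \<open>simp add: D_def\<close>)
    then show ?thesis
      by (simp add: has_field_derivative_def differential_def)
  qed
  define r where "r = f0 * (1 - f0 / Nf)"
  have r: "r > 0" using logistic_rate_pos[OF p0(1)] by (simp add: r_def)
  have lf0: "logistic Nf (logit Nf f0) = f0" using p0(1) by (simp add: dom3_def logistic_logit)
  have h': "(h has_real_derivative partial_f \<phi> (K0, L0, f0) * r) (at j0)"
  proof -
    have "((\<lambda>j. logistic Nf (z K0 L0 j)) has_real_derivative r * 1) (at j0)"
    proof (rule DERIV_chain2[of "logistic Nf"])
      show "(logistic Nf has_real_derivative r) (at (z K0 L0 j0))"
        using logistic_deriv[OF pos(3), of "logit Nf f0"] by (simp add: J0 lf0 r_def)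
    qed (auto simp: z_def intro!: derivative_eq_intros)
    moreover have "((\<lambda>x. \<phi> (K0, L0, x)) has_real_derivative partial_f \<phi> (K0, L0, f0))
        (at (logistic Nf (z K0 L0 j0)))"
      using f_deriv[OF p0D] by (simp add: J0 lf0)
    ultimately show ?thesis
      unfolding h_def using DERIV_chain2[of "\<lambda>x. \<phi> (K0, L0, x)"] by fastforce
  qed
  have hnz: "partial_f \<phi> (K0, L0, f0) * r \<noteq> 0" using p0(3) r by simp
  have h0: "h j0 = 0" using factor[OF p0D] p0(2) by (simp add: j0_def)
  have "((\<lambda>j. (h j - h j0) / (j - j0)) \<longlongrightarrow> partial_f \<phi> (K0, L0, f0) * r) (at j0)"
    using h' by (simp add: has_field_derivative_iff)
  then have "eventually (\<lambda>j. (h j - h j0) / (j - j0) \<noteq> 0) (at j0)"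
    using hnz by (rule tendsto_imp_eventually_ne)
  then obtain d where d: "d > 0" "\<And>j. j \<noteq> j0 \<Longrightarrow> dist j j0 < d \<Longrightarrow> h j \<noteq> 0"
    unfolding eventually_at h0 by fastforce
  define V where "V = D \<inter> J -` ball j0 d"
  have "continuous_on D J"
  proof -
    have "continuous_on D (\<lambda>q. (b - a) * (J q + 0))"
      using first_integral_has_derivative[OF _ ab, of _ NK NL Nf c 0]
      unfolding D_def J_def
      by (intro continuous_at_imp_continuous_on) (blast intro: has_derivative_continuous)
    then have "continuous_on D (\<lambda>q. (b - a) * (J q + 0) / (b - a))"
      by (rule continuous_on_divide[OF _ continuous_on_const]) (use ab in auto)
    moreover have "(\<lambda>q. (b - a) * (J q + 0) / (b - a)) = J" using ab by (auto simp: fun_eq_iff)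
    ultimately show ?thesis by (simp only:)
  qed
  then have openV: "open V"
    unfolding V_def using open_dom3 by (auto simp: D_def intro: continuous_open_preimage)
  have V0: "(K0, L0, f0) \<in> V" using p0D d(1) by (simp add: V_def j0_def)
  have zeros: "\<phi> (K, L, f) = 0 \<longleftrightarrow> f = F C (K, L)" if "(K, L, f) \<in> V" for K L f
  proof -
    have D': "(K, L, f) \<in> D" "dist (J (K, L, f)) j0 < d"
      using that by (auto simp: V_def dist_commute)
    have "\<phi> (K, L, f) = 0 \<longleftrightarrow> J (K, L, f) = j0"
      using factor[OF D'(1)] d(2)[OF _ D'(2)] h0 by auto
    also have "\<dots> \<longleftrightarrow> f = F C (K, L)"
      using graph_f5_level_set[of K L f NK NL Nf C a b c] D'(1) C by (simp add: D_def F_def J_def)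
    finally show ?thesis .
  qed
  have graph: "(K, L, F C (K, L)) \<in> V \<and> partial_f \<phi> (K, L, F C (K, L)) \<noteq> 0"
    if KL: "(K, L) \<in> rect NK NL" for K L
  proof
    define f where "f = F C (K, L)"
    have fD: "(K, L, f) \<in> D"
      using graph_f5_in_dom3[OF KL C(1) pos(3)] by (simp add: D_def F_def f_def)
    have fJ: "J (K, L, f) = j0"
      using graph_f5_level_set[of K L f NK NL Nf C a b c] fD C by (simp add: D_def F_def J_def f_def)
    show "(K, L, F C (K, L)) \<in> V"
      using fD fJ d(1) by (simp add: V_def f_def)
    have lf: "logistic Nf (z K L j0) = f"
      using fJ fD by (auto simp: J_def first_integral_def z_def D_def dom3_def logistic_logit)
    have "((\<lambda>j. \<phi> (K, L, logistic Nf (z K L j))) has_real_derivative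
        partial_f \<phi> (K, L, f) * (f * (1 - f / Nf) * 1)) (at j0)"
    proof (rule DERIV_chain2[of "\<lambda>x. \<phi> (K, L, x)"])
      show "((\<lambda>x. \<phi> (K, L, x)) has_real_derivative partial_f \<phi> (K, L, f))
          (at (logistic Nf (z K L j0)))"
        using f_deriv[OF fD] by (simp add: lf)
      show "((\<lambda>j. logistic Nf (z K L j)) has_real_derivative f * (1 - f / Nf) * 1) (at j0)"
      proof (rule DERIV_chain2[of "logistic Nf"])
        show "(logistic Nf has_real_derivative f * (1 - f / Nf)) (at (z K L j0))"
          using logistic_deriv[OF pos(3), of "z K L j0"] by (simp add: lf)
      qed (auto simp: z_def intro!: derivative_eq_intros)
    qed
    moreover have "(\<lambda>j. \<phi> (K, L, logistic Nf (z K L j))) = h"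
      using factor[OF D_logistic[OF KL]] J_logistic by auto
    ultimately have "partial_f \<phi> (K, L, f) * (f * (1 - f / Nf) * 1) = partial_f \<phi> (K0, L0, f0) * r"
      using h' by (auto intro: DERIV_unique)
    then show "partial_f \<phi> (K, L, F C (K, L)) \<noteq> 0"
      using hnz by (auto simp: f_def)
  qed
  show ?thesis
  proof (rule ex1I[of _ C])
    show "C > 0 \<and> (\<exists>V. open V \<and> V \<subseteq> D \<and> (K0, L0, f0) \<in> V
              \<and> (\<forall>(K, L)\<in>rect NK NL. (K, L, F C (K, L)) \<in> V \<and> partial_f \<phi> (K, L, F C (K, L)) \<noteq> 0)
              \<and> (\<forall>K L f. (K, L, f) \<in> V \<longrightarrow> (\<phi> (K, L, f) = 0 \<longleftrightarrow> f = F C (K, L))))"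
      using C(1) openV V0 graph zeros by (intro conjI exI[of _ V]) (auto simp: V_def)
  next
    fix C'
    assume "C' > 0 \<and> (\<exists>V. open V \<and> V \<subseteq> D \<and> (K0, L0, f0) \<in> V
              \<and> (\<forall>(K, L)\<in>rect NK NL. (K, L, F C' (K, L)) \<in> V \<and> partial_f \<phi> (K, L, F C' (K, L)) \<noteq> 0)
              \<and> (\<forall>K L f. (K, L, f) \<in> V \<longrightarrow> (\<phi> (K, L, f) = 0 \<longleftrightarrow> f = F C' (K, L))))"
    then have C': "C' > 0" "f0 = F C' (K0, L0)" using p0(2) by auto
    then have "- ln C' = j0"
      using graph_f5_level_set[OF p0(1) C'(1), of a b c] by (simp add: F_def J_def j0_def)
    then have "ln C' = ln C" using C(2) by simp
    then show "C' = C" using C'(1) C(1) by simp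
  qed
qed

text \<open>On the whole quadrant \<open>f5\<close> has the form \<open>Nf A / (C B + A)\<close> with \<open>A, B > 0\<close>, also beyond the
  carrying capacities. A nonpositive denominator, including the value 0 with its convention for
  division, never gives a positive quotient.\<close>

lemma f5_range_iff:
  assumes "q \<in> quadrant NK NL" "Nf > 0"
  shows "f5 NK NL Nf a b c C q \<in> {0<..<Nf} \<longleftrightarrow> C > 0"
proof -
  obtain K L where q: "q = (K, L)" by (cases q)
  define A B where "A = K powr alpha a b c * L powr beta a b c"
    and "B = \<bar>NK - K\<bar> powr alpha a b c * \<bar>NL - L\<bar> powr beta a b c"
  have A: "A > 0" and B: "B > 0"
    using assms(1) by (auto simp: q quadrant_def A_def B_def)
  have F: "f5 NK NL Nf a b c C q = Nf * A / (C * B + A)"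
    by (simp add: q f5_def A_def B_def mult.assoc)
  show ?thesis
  proof (cases "C * B + A > 0")
    case True
    then show ?thesis using A B assms(2) by (simp add: F field_simps zero_less_mult_iff)
  next
    case False
    then have "Nf * A / (C * B + A) \<le> 0"
      using A assms(2) by (simp add: divide_nonneg_nonpos)
    moreover have "\<not> C > 0" using False A B mult_pos_pos[of C B] by linarith
    ultimately show ?thesis by (simp add: F)
  qed
qed

text \<open>As \<open>\<alpha> + \<beta> = 1\<close>, at least one exponent is nonzero, and the corresponding factor alone moves the
  output through all of \<open>(0, Nf)\<close>.\<close>

lemma f5_image_rect:
  assumes pos: "NK > 0" "NL > 0" "Nf > 0" and ab: "a \<noteq> b" and C: "C > 0" and y: "0 < y" "y < Nf"
  shows "y \<in> f5 NK NL Nf a b c C ` rect NK NL"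
proof -
  have "alpha a b c \<noteq> 0 \<or> beta a b c \<noteq> 0" using alpha_beta(1)[OF ab, of c] by auto
  then obtain s t where st: "alpha a b c * s + beta a b c * t = logit Nf y + ln C"
  proof
    assume "alpha a b c \<noteq> 0"
    then show ?thesis using that[of "(logit Nf y + ln C) / alpha a b c" 0] by simp
  next
    assume "beta a b c \<noteq> 0"
    then show ?thesis using that[of 0 "(logit Nf y + ln C) / beta a b c"] by simp
  qed
  have KL: "(logistic NK s, logistic NL t) \<in> rect NK NL"
    using logistic_bounds pos by (auto simp: rect_def)
  have "f5 NK NL Nf a b c C (logistic NK s, logistic NL t) = y"
    using st pos y by (simp add: f5_logistic[OF KL C] logit_logistic logistic_logit)
  then show ?thesis using KL by force
qed

lemma f5_ranges:
  assumes pos: "NK > 0" "NL > 0" "Nf > 0" and ab: "a \<noteq> b" and C: "C > 0"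
  shows "f5 NK NL Nf a b c C ` rect NK NL = {0<..<Nf}"
    and "f5 NK NL Nf a b c C ` quadrant NK NL = {0<..<Nf}"
proof -
  have sub: "rect NK NL \<subseteq> quadrant NK NL" by (auto simp: rect_def quadrant_def)
  have 1: "f5 NK NL Nf a b c C ` quadrant NK NL \<subseteq> {0<..<Nf}"
    using f5_range_iff[OF _ pos(3)] C by blast
  have 2: "{0<..<Nf} \<subseteq> f5 NK NL Nf a b c C ` rect NK NL"
    using f5_image_rect[OF pos ab C] by auto
  show "f5 NK NL Nf a b c C ` rect NK NL = {0<..<Nf}"
    "f5 NK NL Nf a b c C ` quadrant NK NL = {0<..<Nf}"
    using 1 2 image_mono[OF sub, of "f5 NK NL Nf a b c C"] by blast+
qed

theorem mainTheorem1:
  fixes NK NL Nf a b c :: real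
  assumes "NK > 0" and "NL > 0" and "Nf > 0" and "a \<noteq> b"
  defines "D \<equiv> dom3 NK NL Nf"
    and "X \<equiv> X3 NK NL Nf"
    and "X' \<equiv> X4 NK NL Nf a b c"
    and "\<omega> \<equiv> total_form NK NL Nf a b c"
    and "F \<equiv> f5 NK NL Nf a b c"
  shows "
    \<comment> \<open>the distribution\<close>
    ((\<forall>p. lie_bracket X X' p = 0)
     \<and> integrable_distribution D X X')
    \<comment> \<open>the corresponding total differential equation\<close>
    \<and> (\<forall>p\<in>D. \<forall>v. \<omega> p v = 0 \<longleftrightarrow> (\<exists>s t. v = s *\<^sub>R X p + t *\<^sub>R X' p))
    \<and> (\<forall>\<phi>. C1_on D \<phi> \<longrightarrow>
       ((\<forall>p\<in>D. vf_apply X \<phi> p = 0 \<and> vf_apply X' \<phi> p = 0) \<longleftrightarrow> solves_total D \<omega> \<phi>))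
    \<and> (alpha a b c + beta a b c = 1)
    \<comment> \<open>integrating it yields, for every constant, a solution whose zero set in D is the graph\<close>
    \<and> (\<forall>C>0. \<exists>\<phi>. C1_on D \<phi>
       \<and> (\<forall>p\<in>D. \<forall>v. differential \<phi> p v = \<omega> p v)
       \<and> (\<forall>p\<in>D. vf_apply X \<phi> p = 0 \<and> vf_apply X' \<phi> p = 0)
       \<and> (\<forall>p\<in>D. partial_f \<phi> p \<noteq> 0)
       \<and> (\<forall>K L f. (K, L, f) \<in> D \<longrightarrow> (\<phi> (K, L, f) = 0 \<longleftrightarrow> f = F C (K, L))))
    \<comment> \<open>solving any solution \<phi> = 0 for f near a zero with nonzero f-derivative yields F C\<close>
    \<and> (\<forall>\<phi> K0 L0 f0. C1_on D \<phi>
       \<and> (\<forall>p\<in>D. vf_apply X \<phi> p = 0 \<and> vf_apply X' \<phi> p = 0)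
       \<and> (K0, L0, f0) \<in> D \<and> \<phi> (K0, L0, f0) = 0 \<and> partial_f \<phi> (K0, L0, f0) \<noteq> 0
       \<longrightarrow> (\<exists>!C. C > 0 \<and> (\<exists>V. open V \<and> V \<subseteq> D \<and> (K0, L0, f0) \<in> V
              \<and> (\<forall>(K, L)\<in>rect NK NL. (K, L, F C (K, L)) \<in> V \<and> partial_f \<phi> (K, L, F C (K, L)) \<noteq> 0)
              \<and> (\<forall>K L f. (K, L, f) \<in> V \<longrightarrow> (\<phi> (K, L, f) = 0 \<longleftrightarrow> f = F C (K, L))))))
    \<comment> \<open>the range; positivity of C is exactly what makes the values lie in (0, Nf)\<close>
    \<and> (\<forall>C>0. F C ` rect NK NL = {0<..<Nf} \<and> F C ` quadrant NK NL = {0<..<Nf})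
    \<and> (\<forall>C. \<forall>q\<in>quadrant NK NL. F C q \<in> {0<..<Nf} \<longleftrightarrow> C > 0)
    \<comment> \<open>the value on the excluded lines, where the powers of zero are meaningful\<close>
    \<and> (\<forall>C L. alpha a b c > 0 \<and> L > 0 \<and> L \<noteq> NL \<longrightarrow> F C (NK, L) = Nf)
    \<and> (\<forall>C K. beta a b c > 0 \<and> K > 0 \<and> K \<noteq> NK \<longrightarrow> F C (K, NL) = Nf)"
proof (intro conjI allI ballI impI)
  show "lie_bracket X X' p = 0" for p
    unfolding X_def X'_def by (rule lie_bracket_X3_X4)
  show "integrable_distribution D X X'"
    unfolding D_def X_def X'_def by (rule integrable_X3_X4) fact
  show "\<omega> p v = 0 \<longleftrightarrow> (\<exists>s t. v = s *\<^sub>R X p + t *\<^sub>R X' p)" if "p \<in> D" for p v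
    using kernel_total_form that \<open>a \<noteq> b\<close> unfolding D_def X_def X'_def \<omega>_def by blast
  show "(\<forall>p\<in>D. vf_apply X \<phi> p = 0 \<and> vf_apply X' \<phi> p = 0) \<longleftrightarrow> solves_total D \<omega> \<phi>" for \<phi>
    unfolding D_def X_def X'_def \<omega>_def by (rule solutions_iff_solves_total) fact
  show "alpha a b c + beta a b c = 1" using alpha_beta(1)[OF \<open>a \<noteq> b\<close>] .
next
  fix C :: real
  assume C: "C > 0"
  let ?\<phi> = "\<lambda>q. (b - a) * (first_integral NK NL Nf a b c q + ln C)"
  note sol = first_integral_solution[OF \<open>a \<noteq> b\<close>, where NK = NK and NL = NL and Nf = Nf and c = c and d = "ln C"]
  have "?\<phi> (K, L, f) = 0 \<longleftrightarrow> f = F C (K, L)" if "(K, L, f) \<in> D" for K L f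
    using graph_f5_level_set[OF that[unfolded D_def] C, of a b c] \<open>a \<noteq> b\<close>
    unfolding F_def by auto
  then show "\<exists>\<phi>. C1_on D \<phi>
       \<and> (\<forall>p\<in>D. \<forall>v. differential \<phi> p v = \<omega> p v)
       \<and> (\<forall>p\<in>D. vf_apply X \<phi> p = 0 \<and> vf_apply X' \<phi> p = 0)
       \<and> (\<forall>p\<in>D. partial_f \<phi> p \<noteq> 0)
       \<and> (\<forall>K L f. (K, L, f) \<in> D \<longrightarrow> (\<phi> (K, L, f) = 0 \<longleftrightarrow> f = F C (K, L)))"
    using sol unfolding D_def X_def X'_def \<omega>_def by (intro exI[of _ ?\<phi>]) simp
next
  fix \<phi> K0 L0 f0
  assume "C1_on D \<phi> \<and> (\<forall>p\<in>D. vf_apply X \<phi> p = 0 \<and> vf_apply X' \<phi> p = 0)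
       \<and> (K0, L0, f0) \<in> D \<and> \<phi> (K0, L0, f0) = 0 \<and> partial_f \<phi> (K0, L0, f0) \<noteq> 0"
  then show "\<exists>!C. C > 0 \<and> (\<exists>V. open V \<and> V \<subseteq> D \<and> (K0, L0, f0) \<in> V
              \<and> (\<forall>(K, L)\<in>rect NK NL. (K, L, F C (K, L)) \<in> V \<and> partial_f \<phi> (K, L, F C (K, L)) \<noteq> 0)
              \<and> (\<forall>K L f. (K, L, f) \<in> V \<longrightarrow> (\<phi> (K, L, f) = 0 \<longleftrightarrow> f = F C (K, L))))"
    unfolding D_def X_def X'_def F_def
    by (intro solution_near_regular_zero[OF assms(1-4)]) auto
next
  show "F C ` rect NK NL = {0<..<Nf}" "F C ` quadrant NK NL = {0<..<Nf}" if "C > 0" for C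
    using f5_ranges[OF assms(1-4) that] unfolding F_def by blast+
  show "F C q \<in> {0<..<Nf} \<longleftrightarrow> C > 0" if "q \<in> quadrant NK NL" for C q
    unfolding F_def by (rule f5_range_iff) fact+
  show "F C (NK, L) = Nf" if "alpha a b c > 0 \<and> L > 0 \<and> L \<noteq> NL" for C L
    using that \<open>NK > 0\<close> by (simp add: F_def f5_def)
  show "F C (K, NL) = Nf" if "beta a b c > 0 \<and> K > 0 \<and> K \<noteq> NK" for C K
    using that \<open>NL > 0\<close> by (simp add: F_def f5_def)
qed

end
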